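(* Fix any $\lambda>0$. Let $(\overline U,\overline V)$ be any critical point of $\Phi_\lambda$. Suppose that there exists $\varepsilon>0$ such that the calmness moduli $c_1$ and $c_2$ of $\Upsilon_1$ and $\Upsilon_2$, respectively, on $\mathbb{B}((\overline U,\overline V),\varepsilon)$ satisfy $$2\overline c+\|\mathcal{A}^*(\omega)\|+\sqrt{(2\overline c+\|\mathcal{A}^*(\omega)\|)^2+4\overline c\,\|\mathcal{A}^*(\omega)\|}<\lambda,\qquad \overline c=\max(c_1,c_2).$$ Then $\Phi_\lambda$ has the KL property of exponent $1/2$ at $(\overline U,\overline V)$.
   Context: Let $n\le m$, let $M^*\in\mathbb{R}^{n\times m}$ be a matrix of rank $r^*\ge1$ with $4r^*\le\min(m,n)$, and set $r=r^*$. Let $\mathcal{A}:\mathbb{R}^{n\times m}\to\mathbb{R}^p$ be a linear operator with adjoint $\mathcal{A}^*$ (with respect to the trace inner product on $\mathbb{R}^{n\times m}$), let $\omega\in\mathbb{R}^p$, and let $y=\mathcal{A}(M^* )+\omega$. Define $f(X):=\frac12\|\mathcal{A}(X)-y\|^2$ and $$\Phi_\lambda(U,V):=f(UV^{\mathbb{T}})+\tfrac{\lambda}{2}\big(\|U\|_F^2+\|V\|_F^2\big),\qquad (U,V)\in\mathbb{R}^{n\times r}\times\mathbb{R}^{m\times r};$$ a critical point is a point where $\nabla\Phi_\lambda=0$. $\|\cdot\|_F$ is the Frobenius norm (with $\|(A,B)\|_F^2=\|A\|_F^2+\|B\|_F^2$ on pairs), $\|\cdot\|$ applied to a matrix is the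 spectral norm, and $\mathbb{B}((\overline U,\overline V),\varepsilon)$ is the closed Frobenius-norm ball. Define $$\Upsilon_1(U,V):=[\mathcal{A}^*\mathcal{A}(UV^{\mathbb{T}}-M^* )]V\in\mathbb{R}^{n\times r},\qquad \Upsilon_2(U,V):=[\mathcal{A}^*\mathcal{A}(UV^{\mathbb{T}}-M^* )]^{\mathbb{T}}U\in\mathbb{R}^{m\times r}.$$ The calmness modulus $c_i$ of $\Upsilon_i$ on $\mathbb{B}((\overline U,\overline V),\varepsilon)$ is the smallest constant such that $\|\Upsilon_i(U,V)-\Upsilon_i(\overline U,\overline V)\|_F\le c_i\|(U,V)-(\overline U,\overline V)\|_F$ for all $(U,V)\in\mathbb{B}((\overline U,\overline V),\varepsilon)$. KL property of exponent $1/2$: a continuously differentiable function $h$ has the Kurdyka–Łojasiewicz property with exponent $1/2$ at $\overline x$ if there exist $\eta\in(0,\infty]$, $c>0$ and a neighborhood $\mathcal{U}$ of $\overline x$ such that, with $\varphi(s)=c\sqrt s$, $\varphi'(h(x)-h(\overline x))\,\|\nabla h(x)\|\ge1$ (Euclidean/Frobenius norm) for all $x\in\mathcal{U}$ with $h(\overline x)<h(x)<h(\overline x)+\eta$. *)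

theory Defs
  imports "HOL-Analysis.Analysis"
begin

text \<open>
  A real matrix with rows indexed by \<open>'n\<close> and columns by \<open>'m\<close> has type \<open>real^'m^'n\<close>.  On this type
  the library's \<open>inner\<close> is the trace inner product and \<open>norm\<close> the Frobenius norm; on pairs of
  matrices \<open>norm (U, V)\<close> satisfies \<open>(norm (U, V))\<^sup>2 = (norm U)\<^sup>2 + (norm V)\<^sup>2\<close>.
  Hence \<open>adjoint\<close>, \<open>GDERIV\<close> and \<open>cball\<close> below all refer to the Frobenius geometry.
\<close>

definition spectral_norm :: "real^'m^'n \<Rightarrow> real" where
  "spectral_norm A = onorm ((*v) A)"

definition f_loss :: "(real^'m^'n \<Rightarrow> real^'p) \<Rightarrow> real^'p \<Rightarrow> real^'m^'n \<Rightarrow> real" where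
  "f_loss \<A> y X = 1 / 2 * (norm (\<A> X - y))\<^sup>2"

fun Phi :: "(real^'m^'n \<Rightarrow> real^'p) \<Rightarrow> real^'p \<Rightarrow> real \<Rightarrow> (real^'r^'n) \<times> (real^'r^'m) \<Rightarrow> real" where
  "Phi \<A> y lam (U, V) =
     f_loss \<A> y (U ** transpose V) + lam / 2 * ((norm U)\<^sup>2 + (norm V)\<^sup>2)"

fun Upsilon1 :: "(real^'m^'n \<Rightarrow> real^'p) \<Rightarrow> real^'m^'n \<Rightarrow>
    (real^'r^'n) \<times> (real^'r^'m) \<Rightarrow> real^'r^'n" where
  "Upsilon1 \<A> M (U, V) = adjoint \<A> (\<A> (U ** transpose V - M)) ** V"

fun Upsilon2 :: "(real^'m^'n \<Rightarrow> real^'p) \<Rightarrow> real^'m^'n \<Rightarrow>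
    (real^'r^'n) \<times> (real^'r^'m) \<Rightarrow> real^'r^'m" where
  "Upsilon2 \<A> M (U, V) = transpose (adjoint \<A> (\<A> (U ** transpose V - M))) ** U"

definition critical_point :: "('a::real_inner \<Rightarrow> real) \<Rightarrow> 'a \<Rightarrow> bool" where
  "critical_point h x \<longleftrightarrow> GDERIV h x :> 0"

definition calmness_const ::
    "('a::metric_space \<Rightarrow> 'b::metric_space) \<Rightarrow> 'a \<Rightarrow> real \<Rightarrow> real \<Rightarrow> bool" where
  "calmness_const F z0 \<epsilon> c \<longleftrightarrow> (\<forall>z\<in>cball z0 \<epsilon>. dist (F z) (F z0) \<le> c * dist z z0)"

definition is_calmness_modulus ::
    "('a::metric_space \<Rightarrow> 'b::metric_space) \<Rightarrow> 'a \<Rightarrow> real \<Rightarrow> real \<Rightarrow> bool" where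
  "is_calmness_modulus F z0 \<epsilon> c \<longleftrightarrow>
     calmness_const F z0 \<epsilon> c \<and> (\<forall>c'. calmness_const F z0 \<epsilon> c' \<longrightarrow> c \<le> c')"

text \<open>
  The existentially quantified \<open>g\<close> is the gradient of \<open>h\<close>, which \<open>GDERIV\<close> determines uniquely; its
  continuity says that \<open>h\<close> is continuously differentiable.  \<open>\<eta>\<close> is extended real, so that
  \<open>\<eta> = \<infinity>\<close> is permitted.
\<close>

definition KL_property_half :: "('a::real_inner \<Rightarrow> real) \<Rightarrow> 'a \<Rightarrow> bool" where
  "KL_property_half h x0 \<longleftrightarrow>
     (\<exists>g. (\<forall>x. GDERIV h x :> g x) \<and> continuous_on UNIV g \<and>
       (\<exists>\<eta>::ereal. \<exists>c::real. \<exists>N. \<eta> > 0 \<and> c > 0 \<and> open N \<and> x0 \<in> N \<and>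
         (\<forall>x\<in>N. h x0 < h x \<and> ereal (h x) < ereal (h x0) + \<eta> \<longrightarrow>
            deriv (\<lambda>s. c * sqrt s) (h x - h x0) * norm (g x) \<ge> 1)))"

end

theory Submission
  imports Defs
begin

text \<open>
  At a critical point \<open>z0\<close>, the gradient \<open>g z\<close> of \<open>\<Phi>\<close> is \<open>\<lambda> (z - z0)\<close> up to two perturbations
  of order \<open>\<parallel>z - z0\<parallel>\<close>: the increments of \<open>\<Upsilon>\<^sub>1, \<Upsilon>\<^sub>2\<close>, controlled by the calmness
  moduli, and the multiplication by \<open>A\<^sup>* \<omega>\<close>, controlled by its spectral norm. As the hypothesis makes
  \<open>\<lambda>\<close> dominate both, \<open>\<parallel>g z\<parallel>\<close> lies between two positive multiples of \<open>\<parallel>z - z0\<parallel>\<close> near \<open>z0\<close>.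
  The upper bound and the mean value theorem yield \<open>\<Phi> z - \<Phi> z0 \<le> L \<parallel>z - z0\<parallel>\<^sup>2\<close>, which the lower
  bound turns into the KL inequality.
\<close>

section \<open>From linear gradient bounds to the KL inequality\<close>

lemma KL_property_half_if_gradient_bounds:
  fixes h :: "'a::real_inner \<Rightarrow> real"
  assumes grad: "\<And>x. GDERIV h x :> g x" and cont: "continuous_on UNIV g"
    and "\<epsilon> > 0" "\<kappa> > 0"
    and lower: "\<And>x. x \<in> cball x0 \<epsilon> \<Longrightarrow> \<kappa> * norm (x - x0) \<le> norm (g x)"
    and upper: "\<And>x. x \<in> cball x0 \<epsilon> \<Longrightarrow> norm (g x) \<le> L * norm (x - x0)"
  shows "KL_property_half h x0"
proof -
  \<comment> \<open>Nothing fixes the sign of \<open>L\<close>; \<open>K\<close> keeps the upper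
    bound and makes \<open>c\<close> positive. The choice of \<open>c\<close> gives
    \<open>c / 2 * \<kappa> = sqrt K\<close>, which absorbs the growth constant below.\<close>
  define K where "K = max L 1"
  define c where "c = 2 * sqrt K / \<kappa>"
  have K: "K \<ge> 1" "L \<le> K" by (auto simp: K_def)
  have c: "c > 0" using K \<open>\<kappa> > 0\<close> by (auto simp: c_def)
  \<comment> \<open>Quadratic growth: after the mean value theorem on the segment from
    \<open>x0\<close> to \<open>x\<close>, one factor of the distance comes from the direction and
    the other from the gradient bound.\<close>
  have growth: "h x - h x0 \<le> K * (norm (x - x0))\<^sup>2" if x: "x \<in> cball x0 \<epsilon>" for x
  proof -
    let ?p = "\<lambda>t::real. x0 + t *\<^sub>R (x - x0)"
    have der: "((\<lambda>t. h (?p t)) has_derivative (\<lambda>s. s * (g (?p t) \<bullet> (x - x0)))) (at t)" for t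
    proof -
      have "(?p has_derivative (\<lambda>s. s *\<^sub>R (x - x0))) (at t)"
        by (auto intro!: derivative_eq_intros)
      moreover have "(h has_derivative (\<lambda>v. v \<bullet> g (?p t))) (at (?p t))"
        using grad[of "?p t"] by (simp add: gderiv_def)
      ultimately have "((\<lambda>t. h (?p t)) has_derivative (\<lambda>s. (s *\<^sub>R (x - x0)) \<bullet> g (?p t))) (at t)"
        by (rule has_derivative_compose)
      then show ?thesis by (simp add: inner_commute)
    qed
    have "\<exists>t\<in>{0<..<1}. h (?p 1) - h (?p 0) = (1 - 0) * (g (?p t) \<bullet> (x - x0))"
      by (rule mvt_simple) (auto intro!: has_derivative_at_withinI der)
    then obtain t where t: "0 < t" "t < 1" and eq: "h x - h x0 = g (?p t) \<bullet> (x - x0)"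
      by auto
    \<comment> \<open>The intermediate point is no farther from \<open>x0\<close> than
      \<open>x\<close> is, so it stays in the ball where \<open>upper\<close> applies.\<close>
    have tx: "norm (?p t - x0) \<le> norm (x - x0)"
      using t by (simp add: mult_left_le_one_le)
    have "g (?p t) \<bullet> (x - x0) \<le> norm (g (?p t)) * norm (x - x0)"
      by (rule norm_cauchy_schwarz)
    also have "norm (g (?p t)) \<le> L * norm (?p t - x0)"
      using x tx by (intro upper) (simp add: dist_norm norm_minus_commute)
    also have "\<dots> \<le> K * norm (x - x0)"
      using K tx by (intro mult_mono) auto
    finally show ?thesis
      unfolding eq by (simp add: power2_eq_square mult_right_mono mult.assoc)
  qed
  have main: "1 \<le> deriv (\<lambda>s. c * sqrt s) (h x - h x0) * norm (g x)"
    if x: "x \<in> ball x0 \<epsilon>" and gt: "h x0 < h x" for x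
  proof -
    define d where "d = h x - h x0"
    \<comment> \<open>Positivity makes \<open>sqrt\<close> differentiable at \<open>d\<close>; the
      claim then amounts to \<open>sqrt d \<le> c / 2 * norm (g x)\<close>.\<close>
    have d: "d > 0" using gt by (simp add: d_def)
    have "((\<lambda>s. c * sqrt s) has_real_derivative c * (inverse (sqrt d) / 2)) (at d)"
      using d by (intro DERIV_cmult DERIV_real_sqrt)
    then have deriv: "deriv (\<lambda>s. c * sqrt s) d = c * (inverse (sqrt d) / 2)"
      by (rule DERIV_imp_deriv)
    have "d \<le> K * (norm (x - x0))\<^sup>2" unfolding d_def using x by (intro growth) auto
    then have "sqrt d \<le> sqrt (K * (norm (x - x0))\<^sup>2)" by simp
    also have "\<dots> = sqrt K * norm (x - x0)" by (simp add: real_sqrt_mult)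
    also have "\<dots> = c / 2 * (\<kappa> * norm (x - x0))" using \<open>\<kappa> > 0\<close> by (simp add: c_def)
    also have "\<dots> \<le> c / 2 * norm (g x)" using c x by (intro mult_left_mono lower) auto
    finally have "sqrt d \<le> c / 2 * norm (g x)" .
    then have "1 \<le> c * (inverse (sqrt d) / 2) * norm (g x)"
      using d by (simp add: field_simps)
    then show ?thesis by (simp only: deriv flip: d_def)
  qed
  have "\<exists>\<eta>::ereal. \<exists>c::real. \<exists>N. \<eta> > 0 \<and> c > 0 \<and> open N \<and> x0 \<in> N \<and>
         (\<forall>x\<in>N. h x0 < h x \<and> ereal (h x) < ereal (h x0) + \<eta> \<longrightarrow>
            deriv (\<lambda>s. c * sqrt s) (h x - h x0) * norm (g x) \<ge> 1)"
    \<comment> \<open>The inequality holds on the whole ball without a cap on the values of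
      \<open>h\<close>, so an infinite \<open>\<eta>\<close> serves.\<close>
    using c main \<open>\<epsilon> > 0\<close>
    by (intro exI[of _ \<infinity>] exI[of _ c] exI[of _ "ball x0 \<epsilon>"]) auto
  then show ?thesis unfolding KL_property_half_def using grad cont by blast
qed

section \<open>Matrix products, the trace inner product and the spectral norm\<close>

lemma bounded_bilinear_matrix_matrix_mult:
  "bounded_bilinear ((**) :: real^'m^'n \<Rightarrow> real^'k^'m \<Rightarrow> real^'k^'n)"
  unfolding bilinear_conv_bounded_bilinear[symmetric] bilinear_def
  by (auto intro!: linearI simp: vec_eq_iff matrix_matrix_mult_def
      distrib_left distrib_right sum.distrib sum_distrib_left mult_ac)

lemma bounded_linear_transpose: "bounded_linear (transpose :: real^'m^'n \<Rightarrow> real^'n^'m)"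
  unfolding linear_conv_bounded_linear[symmetric]
  by (intro linearI) (simp_all add: transpose_def vec_eq_iff)

lemma inner_transpose: "transpose A \<bullet> transpose B = A \<bullet> (B :: real^'m^'n)"
  unfolding inner_vec_def transpose_def by (simp add: sum.swap[of _ "UNIV :: 'm set"])

lemma norm_transpose: "norm (transpose A) = norm (A :: real^'m^'n)"
  by (simp add: norm_eq_sqrt_inner inner_transpose)

text \<open>Both sides are the same triple sum taken in different orders.\<close>

lemma inner_matrix_mult_right:
  fixes A :: "real^'m^'n" and B :: "real^'k^'m"
  shows "(A ** B) \<bullet> C = B \<bullet> (transpose A ** C)"
proof -
  let ?t = "\<lambda>i j k. A$i$j * B$j$k * C$i$k"
  have "(A ** B) \<bullet> C = (\<Sum>i\<in>UNIV. \<Sum>k\<in>UNIV. \<Sum>j\<in>UNIV. ?t i j k)"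
    by (simp add: inner_vec_def matrix_matrix_mult_def sum_distrib_right)
  also have "\<dots> = (\<Sum>k\<in>UNIV. \<Sum>i\<in>UNIV. \<Sum>j\<in>UNIV. ?t i j k)"
    by (rule sum.swap)
  also have "\<dots> = (\<Sum>k\<in>UNIV. \<Sum>j\<in>UNIV. \<Sum>i\<in>UNIV. ?t i j k)"
    by (intro sum.cong refl sum.swap)
  also have "\<dots> = (\<Sum>j\<in>UNIV. \<Sum>k\<in>UNIV. \<Sum>i\<in>UNIV. ?t i j k)"
    by (rule sum.swap)
  also have "\<dots> = B \<bullet> (transpose A ** C)"
    by (simp add: inner_vec_def matrix_matrix_mult_def transpose_def sum_distrib_left mult_ac)
  finally show ?thesis .
qed

text \<open>Transposition preserves the inner product and reverses products, which reduces this to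
  \<open>inner_matrix_mult_right\<close>.\<close>

lemma inner_matrix_mult_left:
  fixes A :: "real^'m^'n" and B :: "real^'k^'m"
  shows "(A ** B) \<bullet> C = A \<bullet> (C ** transpose B)"
proof -
  have "(A ** B) \<bullet> C = (transpose B ** transpose A) \<bullet> transpose C"
    by (metis inner_transpose matrix_transpose_mul)
  also have "\<dots> = transpose A \<bullet> (B ** transpose C)"
    by (simp add: inner_matrix_mult_right)
  also have "\<dots> = A \<bullet> (C ** transpose B)"
    by (metis inner_transpose matrix_transpose_mul transpose_transpose)
  finally show ?thesis .
qed

lemma spectral_norm_nonneg: "0 \<le> spectral_norm A"
  unfolding spectral_norm_def by (intro onorm_pos_le) simp

text \<open>The squared Frobenius norm is the sum of the squared column norms, and \<open>A\<close>
  acts on each column of \<open>B\<close> separately.\<close>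

lemma norm_matrix_mult_le:
  fixes A :: "real^'m^'n" and B :: "real^'k^'m"
  shows "norm (A ** B) \<le> spectral_norm A * norm B"
proof -
  have sq: "(norm C)\<^sup>2 = (\<Sum>j\<in>UNIV. (norm (column j C))\<^sup>2)" for C :: "real^'k^'l"
    unfolding power2_norm_eq_inner inner_vec_def column_def
    by (simp add: sum.swap[of _ "UNIV :: 'k set"])
  have "(norm (A ** B))\<^sup>2 = (\<Sum>j\<in>UNIV. (norm (A *v column j B))\<^sup>2)"
    unfolding sq by (simp add: column_def matrix_matrix_mult_def matrix_vector_mult_def)
  also have "\<dots> \<le> (\<Sum>j\<in>UNIV. (spectral_norm A * norm (column j B))\<^sup>2)"
    unfolding spectral_norm_def by (intro sum_mono power_mono onorm) auto
  also have "\<dots> = (spectral_norm A * norm B)\<^sup>2"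
    by (simp add: power_mult_distrib sq[of B] sum_distrib_left)
  finally show ?thesis
    by (rule power2_le_imp_le) (simp add: spectral_norm_nonneg)
qed

text \<open>Duality: moving \<open>transpose A\<close> across the inner product bounds the square of
  \<open>norm ?C\<close> by \<open>spectral_norm A * norm ?C * norm B\<close>; one factor
  \<open>norm ?C\<close> cancels unless it is 0.\<close>

lemma norm_transpose_matrix_mult_le:
  fixes A :: "real^'m^'n" and B :: "real^'k^'n"
  shows "norm (transpose A ** B) \<le> spectral_norm A * norm B"
proof -
  let ?C = "transpose A ** B"
  have "norm ?C * norm ?C = (A ** ?C) \<bullet> B"
    by (simp add: inner_matrix_mult_right flip: power2_norm_eq_inner power2_eq_square)
  also have "\<dots> \<le> norm (A ** ?C) * norm B" by (rule norm_cauchy_schwarz)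
  also have "\<dots> \<le> spectral_norm A * norm ?C * norm B"
    by (intro mult_right_mono norm_matrix_mult_le) simp
  finally have "norm ?C * norm ?C \<le> norm ?C * (spectral_norm A * norm B)"
    by (simp add: mult_ac)
  then show ?thesis
    by (cases "norm ?C = 0") (auto simp: spectral_norm_nonneg)
qed

section \<open>The gradient of \<open>Phi\<close> and its continuity\<close>

definition grad_Phi :: "(real^'m^'n \<Rightarrow> real^'p) \<Rightarrow> real^'p \<Rightarrow> real \<Rightarrow>
    (real^'r^'n) \<times> (real^'r^'m) \<Rightarrow> (real^'r^'n) \<times> (real^'r^'m)" where
  "grad_Phi \<A> y lam z =
     (let G = adjoint \<A> (\<A> (fst z ** transpose (snd z)) - y)
      in (G ** snd z, transpose G ** fst z) + lam *\<^sub>R z)"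

text \<open>Chain rule through the bilinear map (U, V) \<mapsto> U V^T: \<open>?G\<close> is the
  gradient of the loss at the product, and moving the fixed factors across the trace inner product
  yields the two blocks of \<open>grad_Phi\<close>.\<close>

lemma GDERIV_Phi:
  fixes \<A> :: "real^'m^'n \<Rightarrow> real^'p"
  assumes "linear \<A>"
  shows "GDERIV (Phi \<A> y lam) z :> grad_Phi \<A> y lam z"
proof -
  interpret A: bounded_linear \<A> using assms by (simp add: linear_conv_bounded_linear)
  let ?G = "adjoint \<A> (\<A> (fst z ** transpose (snd z)) - y)"
  \<comment> \<open>In this form the product rule for inner products applies; on pairs
    \<open>z \<bullet> z\<close> is the whole regularizer sum.\<close>
  have Phi: "Phi \<A> y lam = (\<lambda>z. 1 / 2 * ((\<A> (fst z ** transpose (snd z)) - y) \<bullet>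
      (\<A> (fst z ** transpose (snd z)) - y)) + lam / 2 * (z \<bullet> z))"
    by (auto simp: fun_eq_iff f_loss_def power2_norm_eq_inner)
  have inner: "(\<A> (fst z ** transpose (snd h) + fst h ** transpose (snd z))) \<bullet>
      (\<A> (fst z ** transpose (snd z)) - y) = snd h \<bullet> (transpose ?G ** fst z) + fst h \<bullet> (?G ** snd z)" for h
  proof -
    have "\<A> X \<bullet> Y = X \<bullet> adjoint \<A> Y" for X Y
      using adjoint_works[OF assms] by (metis inner_commute)
    \<comment> \<open>Transposing both arguments makes \<open>snd h\<close> a left factor, as
      \<open>inner_matrix_mult_left\<close> requires.\<close>
    moreover have "(fst z ** transpose (snd h)) \<bullet> ?G = snd h \<bullet> (transpose ?G ** fst z)"
      by (subst inner_transpose[symmetric]) (simp add: matrix_transpose_mul inner_matrix_mult_left)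
    ultimately show ?thesis
      by (simp add: inner_add_left inner_matrix_mult_left)
  qed
  have "((\<lambda>z. fst z ** transpose (snd z)) has_derivative
      (\<lambda>h. fst z ** transpose (snd h) + fst h ** transpose (snd z))) (at z)"
    by (intro bounded_bilinear.FDERIV[OF bounded_bilinear_matrix_matrix_mult]
        bounded_linear.has_derivative[OF bounded_linear_transpose] derivative_intros)
  then have 1: "((\<lambda>z. \<A> (fst z ** transpose (snd z))) has_derivative
      (\<lambda>h. \<A> (fst z ** transpose (snd h) + fst h ** transpose (snd z)))) (at z)"
    by (rule A.has_derivative)
  let ?D = "\<lambda>h. \<A> (fst z ** transpose (snd h) + fst h ** transpose (snd z))"
  let ?r = "\<A> (fst z ** transpose (snd z)) - y"
  have 2: "((\<lambda>z. \<A> (fst z ** transpose (snd z)) - y) has_derivative ?D) (at z)"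
    using has_derivative_diff[OF 1 has_derivative_const] by simp
  have "(Phi \<A> y lam has_derivative
      (\<lambda>h. 1 / 2 * (?r \<bullet> ?D h + ?D h \<bullet> ?r) + lam / 2 * (z \<bullet> h + h \<bullet> z))) (at z)"
    unfolding Phi
    by (intro has_derivative_add has_derivative_mult_right has_derivative_inner 2 has_derivative_ident)
  moreover have "1 / 2 * (?r \<bullet> ?D h + ?D h \<bullet> ?r) + lam / 2 * (z \<bullet> h + h \<bullet> z)
      = h \<bullet> grad_Phi \<A> y lam z" for h
  proof -
    have "1 / 2 * (?r \<bullet> ?D h + ?D h \<bullet> ?r) + lam / 2 * (z \<bullet> h + h \<bullet> z)
        = ?D h \<bullet> ?r + lam * (h \<bullet> z)"
      by (simp only: inner_commute[of ?r] inner_commute[of z]) simp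
    also have "\<dots> = h \<bullet> grad_Phi \<A> y lam z"
      unfolding inner by (cases h) (simp add: grad_Phi_def Let_def inner_add_right)
    finally show ?thesis .
  qed
  ultimately show ?thesis by (simp add: gderiv_def)
qed

lemma continuous_on_grad_Phi:
  fixes \<A> :: "real^'m^'n \<Rightarrow> real^'p"
  assumes "linear \<A>"
  shows "continuous_on S (grad_Phi \<A> y lam)"
proof -
  have "bounded_linear \<A>" "bounded_linear (adjoint \<A>)"
    using assms by (simp_all add: linear_conv_bounded_linear[symmetric] adjoint_linear)
  note cont = this[THEN bounded_linear.continuous_on]
    bounded_linear.continuous_on[OF bounded_linear_transpose]
    bounded_bilinear.continuous_on[OF bounded_bilinear_matrix_matrix_mult]
  show ?thesis
    unfolding grad_Phi_def Let_def by (intro continuous_intros cont)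
qed

lemma GDERIV_unique:
  assumes "GDERIV f x :> a" "GDERIV f x :> b"
  shows "a = b"
proof -
  have "(\<lambda>h. h \<bullet> a) = (\<lambda>h. h \<bullet> b)"
    using assms unfolding gderiv_def by (rule has_derivative_unique)
  \<comment> \<open>Testing in the direction \<open>a - b\<close> shows that this vector is
    orthogonal to itself.\<close>
  then have "(a - b) \<bullet> a = (a - b) \<bullet> b" by (rule fun_cong)
  then have "(a - b) \<bullet> (a - b) = 0" by (simp add: inner_diff_right)
  then show ?thesis by simp
qed

section \<open>Calmness constants and the gradient near a critical point\<close>

lemma calmness_const_mono:
  "calmness_const F z0 \<epsilon> c \<Longrightarrow> c \<le> c' \<Longrightarrow> calmness_const F z0 \<epsilon> c'"
  unfolding calmness_const_def by (meson mult_right_mono order_trans zero_le_dist)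

text \<open>The ball contains a point other than the center, namely one at distance
  \<open>\<epsilon>\<close> along a basis vector; dividing the calmness inequality there by
  \<open>\<epsilon>\<close> gives the sign.\<close>

lemma calmness_const_nonneg:
  fixes F :: "'a::euclidean_space \<Rightarrow> 'b::metric_space"
  assumes "calmness_const F z0 \<epsilon> c" and "\<epsilon> > 0"
  shows "c \<ge> 0"
proof -
  obtain b :: 'a where b: "b \<in> Basis" using nonempty_Basis by blast
  let ?z = "z0 + \<epsilon> *\<^sub>R b"
  have "0 \<le> dist (F ?z) (F z0)" by simp
  also have "\<dots> \<le> c * dist ?z z0"
    using assms(1) unfolding calmness_const_def
    by (rule bspec) (use b \<open>\<epsilon> > 0\<close> in \<open>simp add: dist_norm\<close>)
  also have "\<dots> = c * \<epsilon>" using b \<open>\<epsilon> > 0\<close> by (simp add: dist_norm)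
  finally show ?thesis using \<open>\<epsilon> > 0\<close> by (simp add: zero_le_mult_iff)
qed

text \<open>The noise enters the gradient linearly in \<open>z\<close>. Subtracting the vanishing
  gradient at \<open>z0\<close> therefore leaves the increments of \<open>Upsilon1\<close> and
  \<open>Upsilon2\<close> and the products of \<open>adjoint \<A> \<omega>\<close> with
  \<open>z - z0\<close>.\<close>

lemma grad_Phi_near_critical:
  fixes \<A> :: "real^'m^'n \<Rightarrow> real^'p" and z z0 :: "(real^'r^'n) \<times> (real^'r^'m)"
  assumes lin: "linear \<A>" and y: "y = \<A> M + \<omega>"
    and crit: "grad_Phi \<A> y lam z0 = 0"
    and z: "z \<in> cball z0 \<epsilon>"
    and c1: "calmness_const (Upsilon1 \<A> M) z0 \<epsilon> c"
    and c2: "calmness_const (Upsilon2 \<A> M) z0 \<epsilon> c"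
  shows "norm (grad_Phi \<A> y lam z - lam *\<^sub>R (z - z0))
         \<le> 2 * (c + spectral_norm (adjoint \<A> \<omega>)) * norm (z - z0)"
proof -
  define W where "W = adjoint \<A> \<omega>"
  define d where "d = z - z0"
  define u1 where "u1 = Upsilon1 \<A> M z - Upsilon1 \<A> M z0"
  define u2 where "u2 = Upsilon2 \<A> M z - Upsilon2 \<A> M z0"
  have grad: "grad_Phi \<A> y lam x = (Upsilon1 \<A> M x, Upsilon2 \<A> M x)
      - (W ** snd x, transpose W ** fst x) + lam *\<^sub>R x" for x :: "(real^'r^'n) \<times> (real^'r^'m)"
  proof -
    have "adjoint \<A> (\<A> (fst x ** transpose (snd x)) - y)
        = adjoint \<A> (\<A> (fst x ** transpose (snd x) - M)) - W"
      using lin adjoint_linear[OF lin]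
      by (simp add: y W_def linear_diff linear_add flip: diff_diff_eq)
    then show ?thesis
      by (cases x) (simp add: grad_Phi_def Let_def
          linear_diff[OF bounded_linear.linear[OF bounded_linear_transpose]]
          bounded_bilinear.diff_left[OF bounded_bilinear_matrix_matrix_mult])
  qed
  have "grad_Phi \<A> y lam z - lam *\<^sub>R d = grad_Phi \<A> y lam z - grad_Phi \<A> y lam z0 - lam *\<^sub>R d"
    by (simp add: crit)
  also have "\<dots> = (u1, u2) - (W ** snd d, transpose W ** fst d)"
    unfolding grad u1_def u2_def d_def
    by (simp add: bounded_bilinear.diff_right[OF bounded_bilinear_matrix_matrix_mult]
        scaleR_diff_right)
  finally have eq: "grad_Phi \<A> y lam z - lam *\<^sub>R d
      = (u1, u2) - (W ** snd d, transpose W ** fst d)" .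
  have u: "norm u1 \<le> c * norm d" "norm u2 \<le> c * norm d"
    using c1 c2 z unfolding calmness_const_def u1_def u2_def d_def dist_norm[symmetric] by auto
  have "norm (W ** snd d) \<le> spectral_norm W * norm d"
    using norm_matrix_mult_le
    by (rule order_trans) (cases d, simp add: mult_left_mono spectral_norm_nonneg norm_snd_le)
  moreover have "norm (transpose W ** fst d) \<le> spectral_norm W * norm d"
    using norm_transpose_matrix_mult_le
    by (rule order_trans) (cases d, simp add: mult_left_mono spectral_norm_nonneg norm_fst_le)
  \<comment> \<open>The factor 2 arises from bounding the norm of each pair by the sum of its
    component norms.\<close>
  ultimately have "norm (u1, u2) + norm (W ** snd d, transpose W ** fst d)
      \<le> (c * norm d + c * norm d) + (spectral_norm W * norm d + spectral_norm W * norm d)"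
    using u by (intro add_mono order_trans[OF norm_Pair_le]) auto
  then show ?thesis
    unfolding W_def[symmetric] d_def[symmetric] eq
    by (intro order_trans[OF norm_triangle_ineq4]) (simp add: algebra_simps)
qed

section \<open>From the condition on \<open>lam\<close> to the two gradient bounds\<close>

theorem theorem4p2:
  fixes Mstar :: "real^'m^'n"
    and \<A> :: "real^'m^'n \<Rightarrow> real^'p"
    and \<omega> y :: "real^'p"
    and lam \<epsilon> c1 c2 cbar :: real
    and Ubar :: "real^'r^'n"
    and Vbar :: "real^'r^'m"
  assumes "CARD('n) \<le> CARD('m)"
    and "rank Mstar = CARD('r)"
    and "4 * CARD('r) \<le> min CARD('m) CARD('n)"
    and "linear \<A>"
    and "y = \<A> Mstar + \<omega>"
    and "lam > 0"
    and "critical_point (Phi \<A> y lam) (Ubar, Vbar)"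
    and "\<epsilon> > 0"
    and "is_calmness_modulus (Upsilon1 \<A> Mstar) (Ubar, Vbar) \<epsilon> c1"
    and "is_calmness_modulus (Upsilon2 \<A> Mstar) (Ubar, Vbar) \<epsilon> c2"
    and "cbar = max c1 c2"
    and "2 * cbar + spectral_norm (adjoint \<A> \<omega>)
           + sqrt ((2 * cbar + spectral_norm (adjoint \<A> \<omega>))\<^sup>2
                   + 4 * cbar * spectral_norm (adjoint \<A> \<omega>)) < lam"
  shows "KL_property_half (Phi \<A> y lam) (Ubar, Vbar)"
proof -
  let ?z0 = "(Ubar, Vbar)" and ?g = "grad_Phi \<A> y lam"
  define s where "s = spectral_norm (adjoint \<A> \<omega>)"
  define b where "b = 2 * (cbar + s)"
  have calm1: "calmness_const (Upsilon1 \<A> Mstar) ?z0 \<epsilon> cbar"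
    and calm2: "calmness_const (Upsilon2 \<A> Mstar) ?z0 \<epsilon> cbar"
    using assms(9-11) by (auto simp: is_calmness_modulus_def elim!: calmness_const_mono)
  have cbar: "cbar \<ge> 0" using calm1 \<open>\<epsilon> > 0\<close> by (rule calmness_const_nonneg)
  have s: "s \<ge> 0" by (simp add: s_def spectral_norm_nonneg)
  define R where "R = sqrt ((2 * cbar + s)\<^sup>2 + 4 * cbar * s)"
  \<comment> \<open>Dropping the nonnegative term \<open>4 * cbar * s\<close> under the root gives
    \<open>lam > 4 * cbar + 2 * s\<close>, which is at least \<open>b\<close>.\<close>
  have "2 * cbar + s \<le> R"
    unfolding R_def using cbar s by (intro real_le_rsqrt) simp
  moreover have "2 * cbar + s + R < lam"
    using assms(12) unfolding R_def s_def .
  ultimately have b: "b < lam"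
    using cbar by (simp add: b_def distrib_left)
  have crit: "?g ?z0 = 0"
    using assms(7) GDERIV_Phi[OF \<open>linear \<A>\<close>] GDERIV_unique unfolding critical_point_def by blast
  have near: "norm (?g z - lam *\<^sub>R (z - ?z0)) \<le> b * norm (z - ?z0)" if "z \<in> cball ?z0 \<epsilon>" for z
    unfolding b_def s_def
    using \<open>linear \<A>\<close> \<open>y = _\<close> crit that calm1 calm2 by (rule grad_Phi_near_critical)
  show ?thesis
  proof (rule KL_property_half_if_gradient_bounds)
    show "GDERIV (Phi \<A> y lam) z :> ?g z" for z using \<open>linear \<A>\<close> by (rule GDERIV_Phi)
    show "continuous_on UNIV ?g" using \<open>linear \<A>\<close> by (rule continuous_on_grad_Phi)
    show "\<epsilon> > 0" by fact
    show "lam - b > 0" using b by simp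
    fix z assume z: "z \<in> cball ?z0 \<epsilon>"
    have n: "norm (lam *\<^sub>R (z - ?z0)) = lam * norm (z - ?z0)" using \<open>lam > 0\<close> by simp
    \<comment> \<open>Both bounds are triangle inequalities around
      \<open>lam *\<^sub>R (z - ?z0)\<close>, from which \<open>?g z\<close> deviates by at most
      \<open>b * norm (z - ?z0)\<close>.\<close>
    show "(lam - b) * norm (z - ?z0) \<le> norm (?g z)"
      using near[OF z] norm_triangle_ineq2[of "lam *\<^sub>R (z - ?z0)" "?g z"]
      unfolding n left_diff_distrib norm_minus_commute[of "lam *\<^sub>R _"] by linarith
    show "norm (?g z) \<le> (lam + b) * norm (z - ?z0)"
      using near[OF z] norm_triangle_ineq2[of "?g z" "lam *\<^sub>R (z - ?z0)"]
      unfolding n distrib_right by linarith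
  qed
qed

end
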